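(* For every $\mathcal{I}\in\mathsf{FCons}(\mathbb{Z})$, $n\ge 1$, $k\ge 0$, all data words $w_0,w_1$, positions $i_0,i_1$ and register valuations $\nu_0,\nu_1$: $(w_0,i_0,\nu_0)$ and $(w_1,i_1,\nu_1)$ satisfy exactly the same formulas of $\mathrm{TPTL}^{n,\mathcal{I}}_k$ if and only if Duplicator has a winning strategy in the game $\mathrm{TG}^{n,\mathcal{I}}_k(w_0,i_0,\nu_0,w_1,i_1,\nu_1)$.
   Context: Data words: infinite sequences $w=(P_0,d_0)(P_1,d_1)\dots$, $P_i\subseteq\mathcal{P}$ ($\mathcal{P}$ finite), $d_i\in\mathbb{N}$; write $d^w_i$. Intervals have endpoints in $\mathbb{Z}\cup\{\pm\infty\}$. TPTL formulas: $\varphi::=p\mid x\in I\mid\neg\varphi\mid\varphi_1\wedge\varphi_2\mid\varphi_1\mathsf{U}\varphi_2\mid x.\varphi$; a register valuation is $\nu:X\to\mathbb{N}$; $(w,i,\nu)\models p$ iff $p\in P_i$; $(w,i,\nu)\models x\in I$ iff $d_i-\nu(x)\in I$; $(w,i,\nu)\models x.\varphi$ iff $(w,i,\nu[x\mapsto d_i])\models\varphi$; $(w,i,\nu)\models\varphi_1\mathsf{U}\varphi_2$ iff there is $j>i$ with $(w,j,\nu)\models\varphi_2$ and $(w,k,\nu)\models\varphi_1$ for all $i<k<j$. Until rank: $\mathrm{urk}(p)=\mathrm{urk}(x\in I)=0$, $\mathrm{urk}(\neg\varphi)=\mathrm{urk}(x.\varphi)=\mathrm{urk}(\varphi)$, $\mathrm{urk}(\varphi_1\wedge\varphi_2)=\max$,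 $\mathrm{urk}(\varphi_1\mathsf{U}\varphi_2)=\max+1$. $\mathsf{FCons}(\mathbb{Z})$: sets $S\cup\{\pm\infty\}$, $S\subseteq\mathbb{Z}$ finite. $\mathrm{TPTL}^{n,\mathcal{I}}_k$: TPTL formulas of until rank $\le k$, with registers among $x_1,\dots,x_n$, and all endpoints of intervals in constraints $x\in I$ belonging to $\mathcal{I}$. $(i_0,\nu_0)$ and $(i_1,\nu_1)$ agree in the atomic formulas of $\mathrm{TPTL}^{n,\mathcal{I}}$ if $(w_0,i_0,\nu_0)$ and $(w_1,i_1,\nu_1)$ satisfy the same $p\in\mathcal{P}$ and the same formulas $x\in I$ with $x\in\{x_1,\dots,x_n\}$ and endpoints of $I$ in $\mathcal{I}$. Game $\mathrm{TG}^{n,\mathcal{I}}_k(w_0,i_0,\nu_0,w_1,i_1,\nu_1)$: if $k=0$, Spoiler wins iff $(i_0,\nu_0),(i_1,\nu_1)$ do not agree in the atomic formulas, else Duplicator wins. If $k>0$: (1) if they do not agree, Spoiler wins; otherwise Spoiler chooses $Y\subseteq\{x_1,\dots,x_n\}$ and sets $\nu'_l=\nu_l[x\mapsto d^{w_l}_{i_l}\text{ for }x\in Y]$ for $l=0,1$, then picks $l\in\{0,1\}$ and $i'_l>i_l$ in $w_l$. (2) Duplicator picks $i'_{1-l}>i_{1-l}$ in $w_{1-l}$; Spoiler wins unless $(i'_0,\nu'_0),(i'_1,\nu'_1)$ agree in the atomic formulas. (3) Spoiler either continues with $\mathrm{TG}^{n,\mathcal{I}}_{k-1}(w_0,i'_0,\nu'_0,w_1,i'_1,\nu'_1)$,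 or (4) picks $i''_{1-l}$ with $i_{1-l}<i''_{1-l}<i'_{1-l}$ and Duplicator must pick $i''_l$ with $i_l<i''_l<i'_l$ such that $(i''_0,\nu'_0),(i''_1,\nu'_1)$ agree in the atomic formulas, else Spoiler wins; then (5) play continues with $\mathrm{TG}^{n,\mathcal{I}}_{k-1}(w_0,i''_0,\nu'_0,w_1,i''_1,\nu'_1)$. Duplicator has a winning strategy if she can avoid Spoiler winning in every round whatever Spoiler does. *)

theory Defs
  imports Main "HOL-Library.Extended"
begin

section \<open>Data words\<close>

type_synonym 'p data_word = "nat \<Rightarrow> 'p set \<times> nat"

definition data_words :: "'p set \<Rightarrow> 'p data_word set" where
  "data_words P = {w. \<forall>i. fst (w i) \<subseteq> P}"

section \<open>Intervals\<close>

text \<open>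
  Intervals are kept as syntactic objects, because a set of integers does not determine the
  endpoints it was written with: \<open>(0,2)\<close> and \<open>[1,1]\<close> contain the same integers. The two
  Booleans tell whether the lower, respectively upper, endpoint is included.
\<close>

datatype ivl = Ivl (lower_closed: bool) (lower: "int extended") (upper: "int extended") (upper_closed: bool)

definition ivl_set :: "ivl \<Rightarrow> int set" where
  "ivl_set J = {z.
     (if lower_closed J then lower J \<le> Fin z else lower J < Fin z) \<and>
     (if upper_closed J then Fin z \<le> upper J else Fin z < upper J)}"

definition endpoints :: "ivl \<Rightarrow> int extended set" where
  "endpoints J = {lower J, upper J}"

definition FCons :: "int extended set set" where
  "FCons = {Fin ` S \<union> {Minf, Pinf} | S. finite S}"

section \<open>TPTL\<close>

text \<open>The registers \<open>x\<^sub>1, x\<^sub>2, \<dots>\<close> are represented by their indices.\<close>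

datatype 'p tptl =
    Prop 'p
  | Constr nat ivl
  | Neg "'p tptl"
  | Conj "'p tptl" "'p tptl"
  | Until "'p tptl" "'p tptl"
  | Freeze nat "'p tptl"

type_synonym valuation = "nat \<Rightarrow> nat"

fun sat :: "'p data_word \<Rightarrow> nat \<Rightarrow> valuation \<Rightarrow> 'p tptl \<Rightarrow> bool" where
  "sat w i \<nu> (Prop p) \<longleftrightarrow> p \<in> fst (w i)"
| "sat w i \<nu> (Constr x J) \<longleftrightarrow> int (snd (w i)) - int (\<nu> x) \<in> ivl_set J"
| "sat w i \<nu> (Neg \<phi>) \<longleftrightarrow> \<not> sat w i \<nu> \<phi>"
| "sat w i \<nu> (Conj \<phi> \<psi>) \<longleftrightarrow> sat w i \<nu> \<phi> \<and> sat w i \<nu> \<psi>"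
| "sat w i \<nu> (Until \<phi> \<psi>) \<longleftrightarrow>
     (\<exists>j>i. sat w j \<nu> \<psi> \<and> (\<forall>k. i < k \<and> k < j \<longrightarrow> sat w k \<nu> \<phi>))"
| "sat w i \<nu> (Freeze x \<phi>) \<longleftrightarrow> sat w i (\<nu>(x := snd (w i))) \<phi>"

fun urk :: "'p tptl \<Rightarrow> nat" where
  "urk (Prop p) = 0"
| "urk (Constr x J) = 0"
| "urk (Neg \<phi>) = urk \<phi>"
| "urk (Conj \<phi> \<psi>) = max (urk \<phi>) (urk \<psi>)"
| "urk (Until \<phi> \<psi>) = max (urk \<phi>) (urk \<psi>) + 1"
| "urk (Freeze x \<phi>) = urk \<phi>"

fun props :: "'p tptl \<Rightarrow> 'p set" where
  "props (Prop p) = {p}"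
| "props (Constr x J) = {}"
| "props (Neg \<phi>) = props \<phi>"
| "props (Conj \<phi> \<psi>) = props \<phi> \<union> props \<psi>"
| "props (Until \<phi> \<psi>) = props \<phi> \<union> props \<psi>"
| "props (Freeze x \<phi>) = props \<phi>"

fun regs :: "'p tptl \<Rightarrow> nat set" where
  "regs (Prop p) = {}"
| "regs (Constr x J) = {x}"
| "regs (Neg \<phi>) = regs \<phi>"
| "regs (Conj \<phi> \<psi>) = regs \<phi> \<union> regs \<psi>"
| "regs (Until \<phi> \<psi>) = regs \<phi> \<union> regs \<psi>"
| "regs (Freeze x \<phi>) = insert x (regs \<phi>)"

fun constr_endpoints :: "'p tptl \<Rightarrow> int extended set" where
  "constr_endpoints (Prop p) = {}"
| "constr_endpoints (Constr x J) = endpoints J"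
| "constr_endpoints (Neg \<phi>) = constr_endpoints \<phi>"
| "constr_endpoints (Conj \<phi> \<psi>) = constr_endpoints \<phi> \<union> constr_endpoints \<psi>"
| "constr_endpoints (Until \<phi> \<psi>) = constr_endpoints \<phi> \<union> constr_endpoints \<psi>"
| "constr_endpoints (Freeze x \<phi>) = constr_endpoints \<phi>"

definition TPTL :: "'p set \<Rightarrow> nat \<Rightarrow> int extended set \<Rightarrow> nat \<Rightarrow> 'p tptl set" where
  "TPTL P n \<I> k =
     {\<phi>. props \<phi> \<subseteq> P \<and> regs \<phi> \<subseteq> {1..n} \<and> constr_endpoints \<phi> \<subseteq> \<I> \<and> urk \<phi> \<le> k}"

section \<open>The game\<close>

text \<open>
  The two words, the current positions in them and the two register valuations are functions of
  the side \<open>l\<close>, where \<open>False\<close> stands for \<open>0\<close> and \<open>True\<close> for \<open>1\<close>; thus \<open>1 - l\<close> is \<open>\<not> l\<close>.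
\<close>

definition sides :: "'a \<Rightarrow> 'a \<Rightarrow> bool \<Rightarrow> 'a" where
  "sides a0 a1 l = (if l then a1 else a0)"

definition agree ::
  "'p set \<Rightarrow> nat \<Rightarrow> int extended set \<Rightarrow> (bool \<Rightarrow> 'p data_word)
   \<Rightarrow> (bool \<Rightarrow> nat) \<Rightarrow> (bool \<Rightarrow> valuation) \<Rightarrow> bool" where
  "agree P n \<I> w i \<nu> \<longleftrightarrow>
     (\<forall>p\<in>P. sat (w False) (i False) (\<nu> False) (Prop p) \<longleftrightarrow>
            sat (w True) (i True) (\<nu> True) (Prop p)) \<and>
     (\<forall>x\<in>{1..n}. \<forall>J. endpoints J \<subseteq> \<I> \<longrightarrow>
        (sat (w False) (i False) (\<nu> False) (Constr x J) \<longleftrightarrow>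
         sat (w True) (i True) (\<nu> True) (Constr x J)))"

text \<open>
  Positions of the game, for fixed words. The number is the number of rounds still to be played
  after the current round, except in \<open>Round\<close>, where the round is yet to start.
  \<^item> \<open>Round k i \<nu>\<close>: the game with \<open>k\<close> rounds starts at \<open>i\<close>, \<open>\<nu>\<close>;
  \<^item> \<open>Answer k i \<nu>' l j\<close>: Spoiler has updated the valuations to \<open>\<nu>'\<close> and picked \<open>j\<close> in word \<open>l\<close>,
    Duplicator has to pick a position in the other word;
  \<^item> \<open>Choose k i \<nu>' l i'\<close>: both players have picked their positions \<open>i'\<close>, and Spoiler decides whether
    to go on from there;
  \<^item> \<open>Answer_between k i \<nu>' l i' m\<close>: Spoiler has picked the intermediate position \<open>m\<close> in
    word \<open>\<not> l\<close>, Duplicator has to pick an intermediate position in word \<open>l\<close>.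
\<close>

datatype position =
    Round nat "bool \<Rightarrow> nat" "bool \<Rightarrow> valuation"
  | Answer nat "bool \<Rightarrow> nat" "bool \<Rightarrow> valuation" bool nat
  | Choose nat "bool \<Rightarrow> nat" "bool \<Rightarrow> valuation" bool "bool \<Rightarrow> nat"
  | Answer_between nat "bool \<Rightarrow> nat" "bool \<Rightarrow> valuation" bool "bool \<Rightarrow> nat" nat

fun duplicator_turn :: "position \<Rightarrow> bool" where
  "duplicator_turn (Round k i \<nu>) \<longleftrightarrow> False"
| "duplicator_turn (Answer k i \<nu> l j) \<longleftrightarrow> True"
| "duplicator_turn (Choose k i \<nu> l i') \<longleftrightarrow> False"
| "duplicator_turn (Answer_between k i \<nu> l i' m) \<longleftrightarrow> True"

inductive move :: "nat \<Rightarrow> (bool \<Rightarrow> 'p data_word) \<Rightarrow> position \<Rightarrow> position \<Rightarrow> bool"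
  for n :: nat and w :: "bool \<Rightarrow> 'p data_word" where
  spoiler_pick:
    "\<lbrakk>Y \<subseteq> {1..n}; \<nu>' = (\<lambda>s x. if x \<in> Y then snd (w s (i s)) else \<nu> s x); i l < j\<rbrakk>
     \<Longrightarrow> move n w (Round (Suc k) i \<nu>) (Answer k i \<nu>' l j)"
| duplicator_answer:
    "i (\<not> l) < j'
     \<Longrightarrow> move n w (Answer k i \<nu>' l j) (Choose k i \<nu>' l (\<lambda>s. if s = l then j else j'))"
| spoiler_continue:
    "move n w (Choose k i \<nu>' l i') (Round k i' \<nu>')"
| spoiler_between:
    "\<lbrakk>i (\<not> l) < m; m < i' (\<not> l)\<rbrakk>
     \<Longrightarrow> move n w (Choose k i \<nu>' l i') (Answer_between k i \<nu>' l i' m)"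
| duplicator_between:
    "\<lbrakk>i l < m'; m' < i' l\<rbrakk>
     \<Longrightarrow> move n w (Answer_between k i \<nu>' l i' m) (Round k (\<lambda>s. if s = l then m' else m) \<nu>')"

text \<open>
  Agreement after Duplicator's pick of an intermediate position is checked in the \<open>Round\<close>
  position reached by it.
\<close>

fun spoiler_won ::
  "'p set \<Rightarrow> nat \<Rightarrow> int extended set \<Rightarrow> (bool \<Rightarrow> 'p data_word) \<Rightarrow> position \<Rightarrow> bool" where
  "spoiler_won P n \<I> w (Round k i \<nu>) \<longleftrightarrow> \<not> agree P n \<I> w i \<nu>"
| "spoiler_won P n \<I> w (Answer k i \<nu>' l j) \<longleftrightarrow> False"
| "spoiler_won P n \<I> w (Choose k i \<nu>' l i') \<longleftrightarrow> \<not> agree P n \<I> w i' \<nu>'"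
| "spoiler_won P n \<I> w (Answer_between k i \<nu>' l i' m) \<longleftrightarrow> False"

text \<open>
  A strategy of Duplicator maps the history of the play, ending in a position where it is her
  turn, to the next position. \<open>play n w \<sigma> q h\<close> says that \<open>h\<close> is the history of a partial play from
  \<open>q\<close> in which Duplicator follows \<open>\<sigma>\<close>.
\<close>

inductive play ::
  "nat \<Rightarrow> (bool \<Rightarrow> 'p data_word) \<Rightarrow> (position list \<Rightarrow> position) \<Rightarrow> position
   \<Rightarrow> position list \<Rightarrow> bool"
  for n :: nat and w :: "bool \<Rightarrow> 'p data_word" and \<sigma> :: "position list \<Rightarrow> position"
    and q :: position where
  start: "play n w \<sigma> q [q]"
| spoiler: "\<lbrakk>play n w \<sigma> q h; \<not> duplicator_turn (last h); move n w (last h) r\<rbrakk>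
     \<Longrightarrow> play n w \<sigma> q (h @ [r])"
| duplicator: "\<lbrakk>play n w \<sigma> q h; duplicator_turn (last h); move n w (last h) (\<sigma> h)\<rbrakk>
     \<Longrightarrow> play n w \<sigma> q (h @ [\<sigma> h])"

text \<open>
  All plays are finite, so Duplicator wins iff Spoiler never does. A strategy without a legal
  move when it is Duplicator's turn is not winning; this covers the case that there is no
  intermediate position she could pick.
\<close>

definition winning_strategy ::
  "'p set \<Rightarrow> nat \<Rightarrow> int extended set \<Rightarrow> (bool \<Rightarrow> 'p data_word) \<Rightarrow> position
   \<Rightarrow> (position list \<Rightarrow> position) \<Rightarrow> bool" where
  "winning_strategy P n \<I> w q \<sigma> \<longleftrightarrow>
     (\<forall>h. play n w \<sigma> q h \<longrightarrow>
        \<not> spoiler_won P n \<I> w (last h) \<and>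
        (duplicator_turn (last h) \<longrightarrow> move n w (last h) (\<sigma> h)))"

definition duplicator_wins_TG ::
  "'p set \<Rightarrow> nat \<Rightarrow> int extended set \<Rightarrow> nat \<Rightarrow> 'p data_word \<Rightarrow> nat \<Rightarrow> valuation
   \<Rightarrow> 'p data_word \<Rightarrow> nat \<Rightarrow> valuation \<Rightarrow> bool" where
  "duplicator_wins_TG P n \<I> k w0 i0 \<nu>0 w1 i1 \<nu>1 \<longleftrightarrow>
     (\<exists>\<sigma>. winning_strategy P n \<I> (sides w0 w1) (Round k (sides i0 i1) (sides \<nu>0 \<nu>1)) \<sigma>)"

end

theory Submission
  imports Defs
begin

text \<open>
  From Duplicator to formulas, one inducts on formulas; freezing a register costs no round because
  Spoiler freezes registers at the start of each round anyway. From formulas to Duplicator, one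
  inducts on the number of rounds: were there no good answer to Spoiler's \<open>j\<close>, a single until
  formula would tell the two sides apart. Usually this formula is built from characteristic
  formulas, which exist because there are finitely many formulas up to equivalence. Here finiteness
  is obtained from the words instead: there are only finitely many positions before \<open>j\<close>, and in the
  other word either only the positions up to the first one equivalent to none of these matter, or
  every position is equivalent to one of them. Hence finitely many separating formulas suffice.
\<close>

section \<open>Equivalence up to a given until rank\<close>

definition tptl_equiv ::
  "'p set \<Rightarrow> nat \<Rightarrow> int extended set \<Rightarrow> nat \<Rightarrow> 'p data_word \<Rightarrow> nat \<Rightarrow> valuation
   \<Rightarrow> 'p data_word \<Rightarrow> nat \<Rightarrow> valuation \<Rightarrow> bool" where
  "tptl_equiv P n \<I> k w i \<nu> w' i' \<nu>' \<longleftrightarrow>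
     (\<forall>\<phi>\<in>TPTL P n \<I> k. sat w i \<nu> \<phi> \<longleftrightarrow> sat w' i' \<nu>' \<phi>)"

lemma tptl_equiv_sym:
  "tptl_equiv P n \<I> k w i \<nu> w' i' \<nu>' \<Longrightarrow> tptl_equiv P n \<I> k w' i' \<nu>' w i \<nu>"
  by (auto simp: tptl_equiv_def)

lemma tptl_equiv_trans:
  "tptl_equiv P n \<I> k w i \<nu> w' i' \<nu>' \<Longrightarrow> tptl_equiv P n \<I> k w' i' \<nu>' w'' i'' \<nu>''
   \<Longrightarrow> tptl_equiv P n \<I> k w i \<nu> w'' i'' \<nu>''"
  by (auto simp: tptl_equiv_def)

lemma Neg_in_TPTL: "Neg \<phi> \<in> TPTL P n \<I> k \<longleftrightarrow> \<phi> \<in> TPTL P n \<I> k"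
  by (simp add: TPTL_def)

lemma Conj_in_TPTL: "Conj \<phi> \<psi> \<in> TPTL P n \<I> k \<longleftrightarrow> \<phi> \<in> TPTL P n \<I> k \<and> \<psi> \<in> TPTL P n \<I> k"
  by (auto simp: TPTL_def)

lemma Until_in_TPTL:
  "Until \<phi> \<psi> \<in> TPTL P n \<I> (Suc k) \<longleftrightarrow> \<phi> \<in> TPTL P n \<I> k \<and> \<psi> \<in> TPTL P n \<I> k"
  by (auto simp: TPTL_def)

lemma Freeze_in_TPTL: "Freeze x \<phi> \<in> TPTL P n \<I> k \<longleftrightarrow> x \<in> {1..n} \<and> \<phi> \<in> TPTL P n \<I> k"
  by (auto simp: TPTL_def)

text \<open>The syntax has no truth constant and \<open>P\<close> may be empty. Since
  \<open>n \<ge> 1\<close> gives a register and \<open>FCons\<close> the infinite endpoints, an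
  unbounded constraint serves as one.\<close>

lemma valid_formula_exists:
  assumes "n \<ge> 1" and "\<I> \<in> FCons"
  obtains \<theta> where "\<theta> \<in> TPTL P n \<I> k" and "\<And>w i \<nu>. sat w i \<nu> \<theta>"
proof
  show "Constr 1 (Ivl False Minf Pinf False) \<in> TPTL P n \<I> k"
    using assms by (auto simp: TPTL_def endpoints_def FCons_def)
  show "\<And>w i \<nu>. sat w i \<nu> (Constr 1 (Ivl False Minf Pinf False))"
    by (simp add: ivl_set_def)
qed

text \<open>A conjunction with one conjunct per element of \<open>S\<close> works; the valid formula
  is the empty conjunction.\<close>

lemma separating_formula_exists:
  assumes "n \<ge> 1" and "\<I> \<in> FCons" and "finite S"
    and "\<And>s. s \<in> S \<Longrightarrow> \<not> tptl_equiv P n \<I> k w i \<nu> w' s \<nu>'"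
  shows "\<exists>\<phi>\<in>TPTL P n \<I> k. sat w i \<nu> \<phi> \<and> (\<forall>s\<in>S. \<not> sat w' s \<nu>' \<phi>)"
  using assms(3,4)
proof (induction S rule: finite_induct)
  case empty
  then show ?case
    using valid_formula_exists[OF assms(1,2)] by (metis empty_iff)
next
  case (insert s S)
  then obtain \<phi> where \<phi>: "\<phi> \<in> TPTL P n \<I> k" "sat w i \<nu> \<phi>" "\<forall>s\<in>S. \<not> sat w' s \<nu>' \<phi>"
    by auto
  \<comment> \<open>Equivalence may fail in either direction; negating if necessary makes the
    separating formula true at \<open>i\<close>.\<close>
  obtain \<psi> where \<psi>: "\<psi> \<in> TPTL P n \<I> k" "sat w i \<nu> \<psi>" "\<not> sat w' s \<nu>' \<psi>"
    using insert.prems[of s] unfolding tptl_equiv_def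
    by (metis insertI1 Neg_in_TPTL sat.simps(3))
  show ?case
    using \<phi> \<psi> by (intro bexI[of _ "Conj \<phi> \<psi>"]) (auto simp: Conj_in_TPTL)
qed

text \<open>One round of the game in terms of formulas: \<open>j'\<close> answers Spoiler's
  \<open>j\<close>, and each intermediate challenge \<open>m'\<close> has an answer
  \<open>m\<close>. One unit of rank pays for the until formula that would detect a failure.\<close>

lemma tptl_equiv_until:
  assumes n: "n \<ge> 1" and \<I>: "\<I> \<in> FCons"
    and eq: "tptl_equiv P n \<I> (Suc k) w i \<nu> w' i' \<nu>'" and "i < j"
  shows "\<exists>j'>i'. tptl_equiv P n \<I> k w j \<nu> w' j' \<nu>' \<and>
           (\<forall>m'. i' < m' \<and> m' < j' \<longrightarrow> (\<exists>m. i < m \<and> m < j \<and> tptl_equiv P n \<I> k w m \<nu> w' m' \<nu>'))"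
proof (rule ccontr)
  assume bad: "\<not> ?thesis"
  define between where "between m' \<longleftrightarrow> (\<exists>m. i < m \<and> m < j \<and> tptl_equiv P n \<I> k w m \<nu> w' m' \<nu>')" for m'
  have bad': "\<not> tptl_equiv P n \<I> k w j \<nu> w' j' \<nu>'"
    if "i' < j'" "\<And>m'. i' < m' \<Longrightarrow> m' < j' \<Longrightarrow> between m'" for j'
    using bad that unfolding between_def by blast
  have until: "sat w i \<nu> (Until \<phi> \<psi>) \<longleftrightarrow> sat w' i' \<nu>' (Until \<phi> \<psi>)"
    if "\<phi> \<in> TPTL P n \<I> k" "\<psi> \<in> TPTL P n \<I> k" for \<phi> \<psi>
    using eq that unfolding tptl_equiv_def by (metis Until_in_TPTL)
  show False
  proof (cases "\<forall>m'>i'. between m'")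
    case True
    \<comment> \<open>By \<open>bad'\<close>, no position after \<open>i'\<close> is equivalent to
      \<open>j\<close>. The formula \<open>\<psi>\<close> is made to fail at every \<open>m\<close>
      between \<open>i\<close> and \<open>j\<close> that is not equivalent to \<open>j\<close>, yet
      any position of \<open>w'\<close> after \<open>i'\<close> where it holds is equivalent to such
      an \<open>m\<close>.\<close>
    let ?S = "{m. i < m \<and> m < j \<and> \<not> tptl_equiv P n \<I> k w j \<nu> w m \<nu>}"
    have "\<exists>\<psi>\<in>TPTL P n \<I> k. sat w j \<nu> \<psi> \<and> (\<forall>s\<in>?S. \<not> sat w s \<nu> \<psi>)"
      by (rule separating_formula_exists[OF n \<I>]) auto
    then obtain \<psi> where \<psi>: "\<psi> \<in> TPTL P n \<I> k" "sat w j \<nu> \<psi>" "\<And>s. s \<in> ?S \<Longrightarrow> \<not> sat w s \<nu> \<psi>"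
      by blast
    obtain \<theta> where \<theta>: "\<theta> \<in> TPTL P n \<I> k" "\<And>w i \<nu>. sat w i \<nu> \<theta>"
      using valid_formula_exists[OF n \<I>] by blast
    have "sat w i \<nu> (Until \<theta> \<psi>)"
      using \<psi>(2) \<theta>(2) \<open>i < j\<close> by auto
    then obtain j' where j': "i' < j'" "sat w' j' \<nu>' \<psi>"
      using until[OF \<theta>(1) \<psi>(1)] by auto
    then obtain m where m: "i < m" "m < j" "tptl_equiv P n \<I> k w m \<nu> w' j' \<nu>'"
      using True unfolding between_def by blast
    have "\<not> tptl_equiv P n \<I> k w j \<nu> w' j' \<nu>'"
      using bad' j'(1) True by blast
    then have "m \<in> ?S"
      using m tptl_equiv_trans by blast
    then show False
      using \<psi>(1,3) j'(2) m(3) unfolding tptl_equiv_def by blast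
  next
    case False
    \<comment> \<open>The first position equivalent to none strictly between \<open>i\<close> and
      \<open>j\<close> acts as a barrier: \<open>\<chi>\<close> marks it and \<open>\<psi>\<close>
      fails up to it, so \<open>Until (Neg \<chi>) \<psi>\<close> holds at \<open>i\<close> but not
      at \<open>i'\<close>.\<close>
    define m' where "m' = (LEAST m'. i' < m' \<and> \<not> between m')"
    have m': "i' < m'" "\<not> between m'"
      using False LeastI_ex[of "\<lambda>m'. i' < m' \<and> \<not> between m'"] unfolding m'_def by blast+
    have below: "between q" if "i' < q" "q < m'" for q
      using that not_less_Least unfolding m'_def by blast
    have "\<exists>\<chi>\<in>TPTL P n \<I> k. sat w' m' \<nu>' \<chi> \<and> (\<forall>s\<in>{i<..<j}. \<not> sat w s \<nu> \<chi>)"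
      using m'(2) by (intro separating_formula_exists[OF n \<I>])
        (auto simp: between_def dest: tptl_equiv_sym)
    then obtain \<chi> where \<chi>: "\<chi> \<in> TPTL P n \<I> k" "sat w' m' \<nu>' \<chi>" "\<And>s. s \<in> {i<..<j} \<Longrightarrow> \<not> sat w s \<nu> \<chi>"
      by blast
    \<comment> \<open>The set includes \<open>m'\<close> itself: \<open>bad'\<close> asks for
      \<open>between\<close> only strictly before the candidate.\<close>
    have "\<exists>\<psi>\<in>TPTL P n \<I> k. sat w j \<nu> \<psi> \<and> (\<forall>s\<in>{i'<..m'}. \<not> sat w' s \<nu>' \<psi>)"
      using bad' below by (intro separating_formula_exists[OF n \<I>]) auto
    then obtain \<psi> where \<psi>: "\<psi> \<in> TPTL P n \<I> k" "sat w j \<nu> \<psi>" "\<And>s. s \<in> {i'<..m'} \<Longrightarrow> \<not> sat w' s \<nu>' \<psi>"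
      by blast
    have "sat w i \<nu> (Until (Neg \<chi>) \<psi>)"
      using \<psi>(2) \<chi>(3) \<open>i < j\<close> by auto
    then have "sat w' i' \<nu>' (Until (Neg \<chi>) \<psi>)"
      using until \<chi>(1) \<psi>(1) by (simp only: Neg_in_TPTL)
    then obtain j' where j': "i' < j'" "sat w' j' \<nu>' \<psi>"
        "\<And>q. i' < q \<Longrightarrow> q < j' \<Longrightarrow> \<not> sat w' q \<nu>' \<chi>"
      by auto
    have "m' < j'"
      using \<psi>(3)[of j'] j'(1,2) by force
    then show False
      using j'(3) m'(1) \<chi>(2) by blast
  qed
qed

section \<open>Freezing several registers at once\<close>

definition freeze :: "nat set \<Rightarrow> 'p data_word \<Rightarrow> nat \<Rightarrow> valuation \<Rightarrow> valuation" where
  "freeze Y w i \<nu> = (\<lambda>x. if x \<in> Y then snd (w i) else \<nu> x)"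

lemma freeze_empty [simp]: "freeze {} w i \<nu> = \<nu>"
  by (simp add: freeze_def)

lemma freeze_insert: "freeze (insert x Y) w i \<nu> = (freeze Y w i \<nu>)(x := snd (w i))"
  by (auto simp: freeze_def)

text \<open>Freezing \<open>Y\<close> amounts to nesting \<open>Freeze\<close> operators at one
  position, which leaves the until rank, and so \<open>k\<close>, unchanged.\<close>

lemma tptl_equiv_freeze:
  assumes "tptl_equiv P n \<I> k w i \<nu> w' i' \<nu>'" and "Y \<subseteq> {1..n}"
  shows "tptl_equiv P n \<I> k w i (freeze Y w i \<nu>) w' i' (freeze Y w' i' \<nu>')"
proof -
  have "finite Y"
    using assms(2) finite_subset by blast
  then show ?thesis
    using assms(2)
  proof (induction Y rule: finite_induct)
    case empty
    then show ?case using assms(1) by simp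
  next
    case (insert x Y)
    then have eq: "tptl_equiv P n \<I> k w i (freeze Y w i \<nu>) w' i' (freeze Y w' i' \<nu>')"
      and "x \<in> {1..n}"
      by auto
    then show ?case
      unfolding tptl_equiv_def freeze_insert by (metis Freeze_in_TPTL sat.simps(6))
  qed
qed

lemma tptl_equiv_imp_agree:
  assumes "tptl_equiv P n \<I> k (w False) (i False) (\<nu> False) (w True) (i True) (\<nu> True)"
  shows "agree P n \<I> w i \<nu>"
proof -
  have "Prop p \<in> TPTL P n \<I> k" if "p \<in> P" for p
    using that by (simp add: TPTL_def)
  moreover have "Constr x J \<in> TPTL P n \<I> k" if "x \<in> {1..n}" "endpoints J \<subseteq> \<I>" for x J
    using that by (simp add: TPTL_def)
  ultimately show ?thesis
    using assms unfolding tptl_equiv_def agree_def by blast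
qed

text \<open>A register just frozen has difference 0 to the current datum on both sides, so its
  constraints cannot tell the sides apart.\<close>

lemma agree_freeze:
  "agree P n \<I> w i \<nu> \<Longrightarrow> agree P n \<I> w i (\<lambda>s. freeze Y (w s) (i s) (\<nu> s))"
  by (auto simp: agree_def freeze_def)

section \<open>Winning positions\<close>

text \<open>Avoiding Spoiler's win is a safety condition, hence a greatest fixed point. It speaks of
  positions alone, so later inductions need not handle histories.\<close>

coinductive dup_wins ::
  "'p set \<Rightarrow> nat \<Rightarrow> int extended set \<Rightarrow> (bool \<Rightarrow> 'p data_word) \<Rightarrow> position \<Rightarrow> bool"
  for P n \<I> w where
  "\<lbrakk>\<not> spoiler_won P n \<I> w q;
    \<not> duplicator_turn q \<Longrightarrow> \<forall>r. move n w q r \<longrightarrow> dup_wins P n \<I> w r;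
    duplicator_turn q \<Longrightarrow> \<exists>r. move n w q r \<and> dup_wins P n \<I> w r\<rbrakk>
   \<Longrightarrow> dup_wins P n \<I> w q"

lemma dup_wins_not_spoiler_won: "dup_wins P n \<I> w q \<Longrightarrow> \<not> spoiler_won P n \<I> w q"
  by (erule dup_wins.cases) simp

lemma dup_wins_spoiler_move:
  "dup_wins P n \<I> w q \<Longrightarrow> \<not> duplicator_turn q \<Longrightarrow> move n w q r \<Longrightarrow> dup_wins P n \<I> w r"
  by (erule dup_wins.cases) simp

lemma dup_wins_duplicator_move:
  "dup_wins P n \<I> w q \<Longrightarrow> duplicator_turn q \<Longrightarrow> \<exists>r. move n w q r \<and> dup_wins P n \<I> w r"
  by (erule dup_wins.cases) simp

text \<open>The last positions of plays following \<open>\<sigma>\<close> are closed under Spoiler's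
  moves and the answers of \<open>\<sigma>\<close>, as coinduction requires.\<close>

lemma winning_strategy_imp_dup_wins:
  assumes "winning_strategy P n \<I> w q \<sigma>"
  shows "dup_wins P n \<I> w q"
proof -
  have "dup_wins P n \<I> w (last h)" if "play n w \<sigma> q h" for h
    using that
  proof (coinduction arbitrary: h)
    case dup_wins
    have "\<not> spoiler_won P n \<I> w (last h)"
      and "duplicator_turn (last h) \<Longrightarrow> move n w (last h) (\<sigma> h)"
      using assms dup_wins unfolding winning_strategy_def by blast+
    moreover have "\<exists>h'. r = last h' \<and> play n w \<sigma> q h'"
      if "\<not> duplicator_turn (last h)" "move n w (last h) r" for r
      using play.spoiler[OF dup_wins that] by (metis last_snoc)
    moreover have "\<exists>h'. \<sigma> h = last h' \<and> play n w \<sigma> q h'"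
      if "duplicator_turn (last h)" "move n w (last h) (\<sigma> h)"
      using play.duplicator[OF dup_wins that] by (metis last_snoc)
    ultimately show ?case
      by blast
  qed
  from this[OF play.start] show ?thesis
    by simp
qed

text \<open>A strategy depending only on the last position suffices: pick any move that stays in
  \<open>dup_wins\<close>.\<close>

lemma dup_wins_imp_winning_strategy:
  assumes "dup_wins P n \<I> w q"
  obtains \<sigma> where "winning_strategy P n \<I> w q \<sigma>"
proof
  let ?\<sigma> = "\<lambda>h. SOME r. move n w (last h) r \<and> dup_wins P n \<I> w r"
  have step: "move n w (last h) (?\<sigma> h) \<and> dup_wins P n \<I> w (?\<sigma> h)"
    if "dup_wins P n \<I> w (last h)" "duplicator_turn (last h)" for h
    using someI_ex[OF dup_wins_duplicator_move[OF that]] .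
  have "dup_wins P n \<I> w (last h)" if "play n w ?\<sigma> q h" for h
    using that
  proof induction
    case start
    then show ?case using assms by simp
  next
    case (spoiler h r)
    then show ?case using dup_wins_spoiler_move by simp
  next
    case (duplicator h)
    then show ?case using step by simp
  qed
  then show "winning_strategy P n \<I> w q ?\<sigma>"
    using step dup_wins_not_spoiler_won unfolding winning_strategy_def by blast
qed

lemma dup_wins_TG_iff:
  "duplicator_wins_TG P n \<I> k w0 i0 \<nu>0 w1 i1 \<nu>1 \<longleftrightarrow>
   dup_wins P n \<I> (sides w0 w1) (Round k (sides i0 i1) (sides \<nu>0 \<nu>1))"
  unfolding duplicator_wins_TG_def
  by (meson winning_strategy_imp_dup_wins dup_wins_imp_winning_strategy)

section \<open>Whole rounds of the game\<close>

inductive_cases move_RoundE: "move n w (Round k i \<nu>) r"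
inductive_cases move_AnswerE: "move n w (Answer k i \<nu> l j) r"
inductive_cases move_ChooseE: "move n w (Choose k i \<nu> l i') r"
inductive_cases move_Answer_betweenE: "move n w (Answer_between k i \<nu> l i' m) r"

lemma dup_wins_Round_agree:
  "dup_wins P n \<I> w (Round k i \<nu>) \<Longrightarrow> agree P n \<I> w i \<nu>"
  using dup_wins_not_spoiler_won by fastforce

lemma dup_wins_Round_freeze:
  assumes "dup_wins P n \<I> w (Round k i \<nu>)" and "Y \<subseteq> {1..n}"
  shows "dup_wins P n \<I> w (Round k i (\<lambda>s. freeze Y (w s) (i s) (\<nu> s)))"
proof (rule dup_wins.intros)
  show "\<not> spoiler_won P n \<I> w (Round k i (\<lambda>s. freeze Y (w s) (i s) (\<nu> s)))"
    using agree_freeze[OF dup_wins_Round_agree[OF assms(1)]] by simp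
  have "move n w (Round k i \<nu>) r"
    if "move n w (Round k i (\<lambda>s. freeze Y (w s) (i s) (\<nu> s))) r" for r
    using that
  proof (rule move_RoundE)
    fix Z l j k'
    let ?\<nu>' = "\<lambda>s x. if x \<in> Z then snd (w s (i s)) else freeze Y (w s) (i s) (\<nu> s) x"
    assume *: "k = Suc k'" "r = Answer k' i ?\<nu>' l j" "Z \<subseteq> {Suc 0..n}" "i l < j"
    have "?\<nu>' = (\<lambda>s x. if x \<in> Z \<union> Y then snd (w s (i s)) else \<nu> s x)"
      by (auto simp: freeze_def fun_eq_iff)
    then show ?thesis
      using * assms(2) move.spoiler_pick[of "Z \<union> Y" n ?\<nu>' w i \<nu> l j k'] by simp
  qed
  then show "\<forall>r. move n w (Round k i (\<lambda>s. freeze Y (w s) (i s) (\<nu> s))) r \<longrightarrow> dup_wins P n \<I> w r"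
    using dup_wins_spoiler_move[OF assms(1)] by simp
qed simp

lemma dup_wins_Round_Suc:
  assumes "dup_wins P n \<I> w (Round (Suc k) i \<nu>)" and "i l < j"
  obtains j' where "i (\<not> l) < j'"
    and "dup_wins P n \<I> w (Round k (\<lambda>s. if s = l then j else j') \<nu>)"
    and "\<And>m. i (\<not> l) < m \<Longrightarrow> m < j' \<Longrightarrow>
          \<exists>m'. i l < m' \<and> m' < j \<and> dup_wins P n \<I> w (Round k (\<lambda>s. if s = l then m' else m) \<nu>)"
proof -
  \<comment> \<open>Spoiler freezes nothing here, because the until operator keeps the
    valuation.\<close>
  have "move n w (Round (Suc k) i \<nu>) (Answer k i \<nu> l j)"
    using move.spoiler_pick[of "{}" n \<nu> w i \<nu>] assms(2) by simp
  then have "dup_wins P n \<I> w (Answer k i \<nu> l j)"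
    using dup_wins_spoiler_move[OF assms(1)] by simp
  then obtain r where "move n w (Answer k i \<nu> l j) r" "dup_wins P n \<I> w r"
    using dup_wins_duplicator_move by fastforce
  then obtain j' where j': "i (\<not> l) < j'"
      "dup_wins P n \<I> w (Choose k i \<nu> l (\<lambda>s. if s = l then j else j'))"
    by (auto elim: move_AnswerE)
  let ?i' = "\<lambda>s. if s = l then j else j'"
  have choose: "dup_wins P n \<I> w r" if "move n w (Choose k i \<nu> l ?i') r" for r
    using dup_wins_spoiler_move[OF j'(2) _ that] by simp
  show ?thesis
  proof
    show "i (\<not> l) < j'" by fact
    show "dup_wins P n \<I> w (Round k ?i' \<nu>)"
      by (rule choose[OF move.spoiler_continue])
    fix m assume m: "i (\<not> l) < m" "m < j'"
    have "dup_wins P n \<I> w (Answer_between k i \<nu> l ?i' m)"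
      using m by (intro choose move.spoiler_between) auto
    then obtain r where "move n w (Answer_between k i \<nu> l ?i' m) r" "dup_wins P n \<I> w r"
      using dup_wins_duplicator_move by fastforce
    then show "\<exists>m'. i l < m' \<and> m' < j \<and> dup_wins P n \<I> w (Round k (\<lambda>s. if s = l then m' else m) \<nu>)"
      by (auto elim!: move_Answer_betweenE)
  qed
qed

text \<open>Condenses the positions inside a round into one condition on Duplicator's answers. For
  \<open>k = 0\<close> that condition is vacuous, as Spoiler has no move.\<close>

lemma dup_wins_RoundI:
  assumes "agree P n \<I> w i \<nu>"
    and "\<And>k' Y l j. k = Suc k' \<Longrightarrow> Y \<subseteq> {1..n} \<Longrightarrow> i l < j \<Longrightarrow>
      \<exists>j'>i (\<not> l). dup_wins P n \<I> w
           (Round k' (\<lambda>s. if s = l then j else j') (\<lambda>s. freeze Y (w s) (i s) (\<nu> s))) \<and>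
         (\<forall>m. i (\<not> l) < m \<and> m < j' \<longrightarrow> (\<exists>m'. i l < m' \<and> m' < j \<and> dup_wins P n \<I> w
           (Round k' (\<lambda>s. if s = l then m' else m) (\<lambda>s. freeze Y (w s) (i s) (\<nu> s)))))"
  shows "dup_wins P n \<I> w (Round k i \<nu>)"
proof (rule dup_wins.intros)
  show "\<forall>r. move n w (Round k i \<nu>) r \<longrightarrow> dup_wins P n \<I> w r"
  proof (intro allI impI)
    fix r
    assume "move n w (Round k i \<nu>) r"
    then show "dup_wins P n \<I> w r"
    proof (rule move_RoundE)
      fix Y l j k'
      let ?\<nu>' = "\<lambda>s. freeze Y (w s) (i s) (\<nu> s)"
      assume *: "k = Suc k'" "r = Answer k' i (\<lambda>s x. if x \<in> Y then snd (w s (i s)) else \<nu> s x) l j"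
        "Y \<subseteq> {Suc 0..n}" "i l < j"
      have Y: "Y \<subseteq> {1..n}"
        using *(3) by simp
      obtain j' where j': "i (\<not> l) < j'"
          "dup_wins P n \<I> w (Round k' (\<lambda>s. if s = l then j else j') ?\<nu>')"
          "\<And>m. i (\<not> l) < m \<Longrightarrow> m < j' \<Longrightarrow>
             \<exists>m'. i l < m' \<and> m' < j \<and> dup_wins P n \<I> w (Round k' (\<lambda>s. if s = l then m' else m) ?\<nu>')"
        using assms(2)[OF *(1) Y *(4)] by blast
      let ?i' = "\<lambda>s. if s = l then j else j'"
      \<comment> \<open>The round is settled backwards: first \<open>Answer_between\<close>, then
        \<open>Choose\<close>, then \<open>Answer\<close>.\<close>
      have between: "dup_wins P n \<I> w (Answer_between k' i ?\<nu>' l ?i' m)"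
        if m: "i (\<not> l) < m" "m < j'" for m
      proof -
        obtain m' where m': "i l < m'" "m' < j"
            "dup_wins P n \<I> w (Round k' (\<lambda>s. if s = l then m' else m) ?\<nu>')"
          using j'(3)[OF m] by blast
        have "move n w (Answer_between k' i ?\<nu>' l ?i' m) (Round k' (\<lambda>s. if s = l then m' else m) ?\<nu>')"
          using m' by (intro move.duplicator_between) auto
        then show ?thesis
          using m'(3) by (intro dup_wins.intros) auto
      qed
      have "dup_wins P n \<I> w q" if "move n w (Choose k' i ?\<nu>' l ?i') q" for q
        using that j'(2) between by (auto elim!: move_ChooseE)
      then have "dup_wins P n \<I> w (Choose k' i ?\<nu>' l ?i')"
        using dup_wins_Round_agree[OF j'(2)] by (intro dup_wins.intros) auto
      moreover have "move n w (Answer k' i ?\<nu>' l j) (Choose k' i ?\<nu>' l ?i')"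
        using j'(1) by (rule move.duplicator_answer)
      ultimately have "dup_wins P n \<I> w (Answer k' i ?\<nu>' l j)"
        by (intro dup_wins.intros) auto
      then show ?thesis
        using *(2) by (simp add: freeze_def)
    qed
  qed
qed (use assms(1) in simp_all)

section \<open>Winning positions and equivalence\<close>

text \<open>The side \<open>l\<close> is arbitrary because in the until case Spoiler plays in the
  word where the formula holds, which may be either one.\<close>

lemma dup_wins_imp_sat_iff:
  assumes "\<phi> \<in> TPTL P n \<I> k" and "dup_wins P n \<I> w (Round k i \<nu>)"
  shows "sat (w l) (i l) (\<nu> l) \<phi> \<longleftrightarrow> sat (w (\<not> l)) (i (\<not> l)) (\<nu> (\<not> l)) \<phi>"
  using assms
proof (induction \<phi> arbitrary: k i \<nu> l)
  case (Prop p)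
  then have "p \<in> P" by (simp add: TPTL_def)
  then show ?case
    using dup_wins_Round_agree[OF Prop.prems(2)] by (cases l) (auto simp: agree_def)
next
  case (Constr x J)
  then have "x \<in> {1..n}" "endpoints J \<subseteq> \<I>" by (simp_all add: TPTL_def)
  then show ?case
    using dup_wins_Round_agree[OF Constr.prems(2)] unfolding agree_def by (cases l) simp_all
next
  case (Neg \<phi>)
  then show ?case unfolding Neg_in_TPTL sat.simps by blast
next
  case (Conj \<phi> \<psi>)
  then show ?case unfolding Conj_in_TPTL sat.simps by blast
next
  case (Until \<phi> \<psi>)
  obtain k' where k: "k = Suc k'"
    using Until.prems(1) by (cases k) (auto simp: TPTL_def)
  have mem: "\<phi> \<in> TPTL P n \<I> k'" "\<psi> \<in> TPTL P n \<I> k'"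
    using Until.prems(1) unfolding k Until_in_TPTL by auto
  have "sat (w (\<not> l)) (i (\<not> l)) (\<nu> (\<not> l)) (Until \<phi> \<psi>)"
    if sat: "sat (w l) (i l) (\<nu> l) (Until \<phi> \<psi>)" for l
  proof -
    obtain j where j: "i l < j" "sat (w l) j (\<nu> l) \<psi>"
        "\<And>m. i l < m \<Longrightarrow> m < j \<Longrightarrow> sat (w l) m (\<nu> l) \<phi>"
      using sat by auto
    \<comment> \<open>Spoiler plays the until witness \<open>j\<close>, and the answer
      \<open>j'\<close> is the witness in the other word. Each \<open>m\<close> before
      \<open>j'\<close> becomes an intermediate challenge, answered before \<open>j\<close>, where
      \<open>\<phi>\<close> holds.\<close>
    obtain j' where j': "i (\<not> l) < j'"
        "dup_wins P n \<I> w (Round k' (\<lambda>s. if s = l then j else j') \<nu>)"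
        "\<And>m. i (\<not> l) < m \<Longrightarrow> m < j' \<Longrightarrow>
          \<exists>m'. i l < m' \<and> m' < j \<and> dup_wins P n \<I> w (Round k' (\<lambda>s. if s = l then m' else m) \<nu>)"
      using dup_wins_Round_Suc[OF Until.prems(2)[unfolded k] j(1)] by blast
    have "sat (w (\<not> l)) j' (\<nu> (\<not> l)) \<psi>"
      using Until.IH(2)[OF mem(2) j'(2), of l] j(2) by simp
    moreover have "sat (w (\<not> l)) m (\<nu> (\<not> l)) \<phi>" if m: "i (\<not> l) < m" "m < j'" for m
    proof -
      obtain m' where m': "i l < m'" "m' < j"
          "dup_wins P n \<I> w (Round k' (\<lambda>s. if s = l then m' else m) \<nu>)"
        using j'(3)[OF m] by blast
      then show ?thesis
        using Until.IH(1)[OF mem(1) m'(3), of l] j(3) by simp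
    qed
    ultimately show ?thesis
      using j'(1) by auto
  qed
  from this[of l] this[of "\<not> l"] show ?case
    by (metis (full_types))
next
  case (Freeze x \<phi>)
  then have mem: "{x} \<subseteq> {1..n}" "\<phi> \<in> TPTL P n \<I> k"
    by (simp_all add: Freeze_in_TPTL)
  show ?case
    using Freeze.IH[OF mem(2) dup_wins_Round_freeze[OF Freeze.prems(2) mem(1)], of l]
    by (simp only: freeze_insert freeze_empty sat.simps)
qed

text \<open>In each round, freezing keeps rank \<open>Suc k\<close>; then
  \<open>tptl_equiv_until\<close> gives answers equivalent at rank \<open>k\<close>, to which the
  induction hypothesis applies.\<close>

lemma tptl_equiv_imp_dup_wins:
  assumes n: "n \<ge> 1" and \<I>: "\<I> \<in> FCons"
    and "tptl_equiv P n \<I> k (w False) (i False) (\<nu> False) (w True) (i True) (\<nu> True)"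
  shows "dup_wins P n \<I> w (Round k i \<nu>)"
  using assms(3)
proof (induction k arbitrary: i \<nu>)
  case 0
  then show ?case
    using tptl_equiv_imp_agree by (intro dup_wins_RoundI) auto
next
  case (Suc k)
  \<comment> \<open>The induction hypothesis compares \<open>False\<close> with \<open>True\<close>,
    but Spoiler may pick in either word; symmetry covers \<open>l = True\<close>.\<close>
  have IH: "dup_wins P n \<I> w (Round k (\<lambda>s. if s = l then a else b) \<nu>')"
    if "tptl_equiv P n \<I> k (w l) a (\<nu>' l) (w (\<not> l)) b (\<nu>' (\<not> l))" for l a b \<nu>'
    using that by (intro Suc.IH) (cases l; auto dest: tptl_equiv_sym)
  show ?case
  proof (rule dup_wins_RoundI)
    show "agree P n \<I> w i \<nu>"
      using Suc.prems by (rule tptl_equiv_imp_agree)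
    fix k' Y l j
    let ?\<nu>' = "\<lambda>s. freeze Y (w s) (i s) (\<nu> s)"
    assume "Suc k = Suc k'" and Y: "Y \<subseteq> {1..n}" and j: "i l < j"
    then have k': "k' = k" by simp
    have "tptl_equiv P n \<I> (Suc k) (w l) (i l) (?\<nu>' l) (w (\<not> l)) (i (\<not> l)) (?\<nu>' (\<not> l))"
      using tptl_equiv_freeze[OF Suc.prems Y] by (cases l) (auto dest: tptl_equiv_sym)
    from tptl_equiv_until[OF n \<I> this j]
    show "\<exists>j'>i (\<not> l). dup_wins P n \<I> w (Round k' (\<lambda>s. if s = l then j else j') ?\<nu>') \<and>
           (\<forall>m. i (\<not> l) < m \<and> m < j' \<longrightarrow> (\<exists>m'. i l < m' \<and> m' < j \<and>
             dup_wins P n \<I> w (Round k' (\<lambda>s. if s = l then m' else m) ?\<nu>')))"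
      unfolding k' using IH[of l _ ?\<nu>'] by meson
  qed
qed

theorem theorem4:
  fixes P :: "'p set" and \<I> :: "int extended set" and n k :: nat
    and w0 w1 :: "'p data_word" and i0 i1 :: nat and \<nu>0 \<nu>1 :: valuation
  assumes "finite P" and "\<I> \<in> FCons" and "n \<ge> 1"
    and "w0 \<in> data_words P" and "w1 \<in> data_words P"
  shows "(\<forall>\<phi>\<in>TPTL P n \<I> k. sat w0 i0 \<nu>0 \<phi> \<longleftrightarrow> sat w1 i1 \<nu>1 \<phi>) \<longleftrightarrow>
         duplicator_wins_TG P n \<I> k w0 i0 \<nu>0 w1 i1 \<nu>1"
proof -
  let ?w = "sides w0 w1" and ?i = "sides i0 i1" and ?\<nu> = "sides \<nu>0 \<nu>1"
  have "tptl_equiv P n \<I> k w0 i0 \<nu>0 w1 i1 \<nu>1 \<longleftrightarrow> dup_wins P n \<I> ?w (Round k ?i ?\<nu>)"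
  proof
    assume "tptl_equiv P n \<I> k w0 i0 \<nu>0 w1 i1 \<nu>1"
    then show "dup_wins P n \<I> ?w (Round k ?i ?\<nu>)"
      using assms(2,3) by (intro tptl_equiv_imp_dup_wins) (simp_all add: sides_def)
  next
    assume "dup_wins P n \<I> ?w (Round k ?i ?\<nu>)"
    then show "tptl_equiv P n \<I> k w0 i0 \<nu>0 w1 i1 \<nu>1"
      using dup_wins_imp_sat_iff[of _ P n \<I> k ?w ?i ?\<nu> False]
      by (simp add: tptl_equiv_def sides_def)
  qed
  then show ?thesis
    by (simp add: tptl_equiv_def dup_wins_TG_iff)
qed

end
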